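(* Let $M$ be an infinite complete metric space and let $e\in M$. Assume that $M$ has at least two connected components, one of them with at least two points, and that there is a non-empty closed set $S\subsetneq M$ such that $$\mathrm{dist}(S,M\setminus S):=\inf\{d(x,y): x\in S,\ y\in M\setminus S\}>0.$$ Then $T_{f,e}\colon\mathcal F(M,e)\to\mathcal F(M,e)$ admits a non-trivial invariant subspace for every Lipschitz map $f\colon M\to M$.
   Context: $\mathbb K$ denotes $\mathbb R$ or $\mathbb C$. For a metric space $M$ and $e\in M$, $\mathrm{Lip}_0(M,e)$ is the Banach space of Lipschitz functions $\varphi\colon M\to\mathbb K$ with $\varphi(e)=0$, normed by the best Lipschitz constant. For $x\in M$, $\delta(x)=\delta_e(x)\in \mathrm{Lip}_0(M,e)^*$ is the evaluation functional $\varphi\mapsto\varphi(x)$. The Lipschitz-free space with basepoint $e$ is $\mathcal F(M,e):=\overline{\mathrm{span}}\{\delta(x):x\in M\}\subset \mathrm{Lip}_0(M,e)^*$ (norm closure). For a Lipschitz map $f\colon M\to M$ (not assumed to fix $e$), $T_{f,e}\colon\mathcal F(M,e)\to\mathcal F(M,e)$ is the unique bounded linear operator with $T_{f,e}(\delta(x))=\delta(f(x))-\delta(f(e))$ for all $x\in M$. A non-trivial invariant subspace of a bounded operator $T\colon X\to X$ is a closed linear subspace $S$ with $\{0\}\subsetneq S\subsetneq X$ and $T(S)\subset S$. *)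

theory Defs
  imports "HOL-Analysis.Analysis" "HOL-Library.Function_Algebras"
begin

text \<open>
  The scalar field \<open>'k::real_normed_field\<close> is meant to be \<open>real\<close> or \<open>complex\<close>.  The space
  \<open>Lip_0(M,e)\<close> and its dual depend on the point \<open>e\<close>, so they are carrier sets in function types,
  with the pointwise operations.
\<close>

definition scale_fun :: "'k::real_normed_field \<Rightarrow> ('i \<Rightarrow> 'k) \<Rightarrow> 'i \<Rightarrow> 'k"
  where "scale_fun c g = (\<lambda>x. c * g x)"

interpretation fun_vs: vector_space scale_fun
  by standard (auto simp: scale_fun_def fun_eq_iff algebra_simps)

definition linear_on_carrier ::
  "('k \<Rightarrow> 'v \<Rightarrow> 'v) \<Rightarrow> ('k \<Rightarrow> 'w \<Rightarrow> 'w) \<Rightarrow> 'v::plus set \<Rightarrow> ('v \<Rightarrow> 'w::plus) \<Rightarrow> bool"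
  where "linear_on_carrier s1 s2 V L \<longleftrightarrow>
    (\<forall>u\<in>V. \<forall>v\<in>V. L (u + v) = L u + L v) \<and> (\<forall>c. \<forall>u\<in>V. L (s1 c u) = s2 c (L u))"

definition lip0 :: "'a::metric_space \<Rightarrow> ('a \<Rightarrow> 'k::real_normed_field) set"
  where "lip0 e = {\<phi>. (\<exists>C. C-lipschitz_on UNIV \<phi>) \<and> \<phi> e = 0}"

definition lip_norm :: "('a::metric_space \<Rightarrow> 'k::real_normed_field) \<Rightarrow> real"
  where "lip_norm \<phi> = Inf {C. C-lipschitz_on UNIV \<phi>}"

text \<open>Functionals are set to \<open>0\<close> off \<open>lip0 e\<close>, so that equality in the dual is equality of functions.\<close>

definition lip0_dual :: "'a::metric_space \<Rightarrow> (('a \<Rightarrow> 'k::real_normed_field) \<Rightarrow> 'k) set"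
  where "lip0_dual e = {\<mu>. linear_on_carrier scale_fun (*) (lip0 e) \<mu> \<and>
    (\<exists>B. \<forall>\<phi>\<in>lip0 e. norm (\<mu> \<phi>) \<le> B * lip_norm \<phi>) \<and> (\<forall>\<phi>. \<phi> \<notin> lip0 e \<longrightarrow> \<mu> \<phi> = 0)}"

definition dual_norm :: "'a::metric_space \<Rightarrow> (('a \<Rightarrow> 'k::real_normed_field) \<Rightarrow> 'k) \<Rightarrow> real"
  where "dual_norm e \<mu> = (SUP \<phi>\<in>{\<phi>\<in>lip0 e. lip_norm \<phi> \<le> 1}. norm (\<mu> \<phi>))"

text \<open>
  The locale \<open>Metric_space\<close> requires non-negativity and symmetry also off the carrier, where the
  supremum above may be that of an unbounded set.
\<close>

definition dual_dist ::
  "'a::metric_space \<Rightarrow> (('a \<Rightarrow> 'k::real_normed_field) \<Rightarrow> 'k) \<Rightarrow> (('a \<Rightarrow> 'k) \<Rightarrow> 'k) \<Rightarrow> real"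
  where "dual_dist e \<mu> \<nu> =
    (if \<mu> \<in> lip0_dual e \<and> \<nu> \<in> lip0_dual e then dual_norm e (\<mu> - \<nu>) else 0)"

definition dual_topology ::
  "'a::metric_space \<Rightarrow> (('a \<Rightarrow> 'k::real_normed_field) \<Rightarrow> 'k) topology"
  where "dual_topology e = Metric_space.mtopology (lip0_dual e) (dual_dist e)"

definition delta :: "'a::metric_space \<Rightarrow> 'a \<Rightarrow> ('a \<Rightarrow> 'k::real_normed_field) \<Rightarrow> 'k"
  where "delta e x = (\<lambda>\<phi>. if \<phi> \<in> lip0 e then \<phi> x else 0)"

definition free_space :: "'a::metric_space \<Rightarrow> (('a \<Rightarrow> 'k::real_normed_field) \<Rightarrow> 'k) set"
  where "free_space e = dual_topology e closure_of fun_vs.span (range (delta e))"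

definition bounded_operator_on_free_space ::
  "'a::metric_space \<Rightarrow> ((('a \<Rightarrow> 'k::real_normed_field) \<Rightarrow> 'k) \<Rightarrow> (('a \<Rightarrow> 'k) \<Rightarrow> 'k)) \<Rightarrow> bool"
  where "bounded_operator_on_free_space e T \<longleftrightarrow>
    T ` free_space e \<subseteq> free_space e \<and>
    linear_on_carrier scale_fun scale_fun (free_space e) T \<and>
    (\<exists>B. \<forall>\<mu>\<in>free_space e. dual_norm e (T \<mu>) \<le> B * dual_norm e \<mu>)"

text \<open>The last conjunct only normalises \<open>T\<close> off its domain; see \<open>ex1_free_operator\<close> below.\<close>

definition is_free_operator ::
  "('a::metric_space \<Rightarrow> 'a) \<Rightarrow> 'a \<Rightarrow>
    ((('a \<Rightarrow> 'k::real_normed_field) \<Rightarrow> 'k) \<Rightarrow> (('a \<Rightarrow> 'k) \<Rightarrow> 'k)) \<Rightarrow> bool"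
  where "is_free_operator f e T \<longleftrightarrow>
    bounded_operator_on_free_space e T \<and>
    (\<forall>x. T (delta e x) = delta e (f x) - delta e (f e)) \<and>
    (\<forall>\<mu>. \<mu> \<notin> free_space e \<longrightarrow> T \<mu> = 0)"

definition free_operator ::
  "('a::metric_space \<Rightarrow> 'a) \<Rightarrow> 'a \<Rightarrow>
    (('a \<Rightarrow> 'k::real_normed_field) \<Rightarrow> 'k) \<Rightarrow> (('a \<Rightarrow> 'k) \<Rightarrow> 'k)"
  where "free_operator f e = (THE T. is_free_operator f e T)"

definition nontrivial_invariant_subspace ::
  "'a::metric_space \<Rightarrow> ((('a \<Rightarrow> 'k::real_normed_field) \<Rightarrow> 'k) \<Rightarrow> (('a \<Rightarrow> 'k) \<Rightarrow> 'k)) \<Rightarrow>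
    (('a \<Rightarrow> 'k) \<Rightarrow> 'k) set \<Rightarrow> bool"
  where "nontrivial_invariant_subspace e T N \<longleftrightarrow>
    fun_vs.subspace N \<and> closedin (subtopology (dual_topology e) (free_space e)) N \<and>
    {0} \<subset> N \<and> N \<subset> free_space e \<and> T ` N \<subseteq> N"


subsection \<open>Well-definedness\<close>

lemma lip_norm_lipschitz:
  fixes \<phi> :: "'a::metric_space \<Rightarrow> 'k::real_normed_field"
  assumes "C-lipschitz_on UNIV \<phi>"
  shows "(lip_norm \<phi>)-lipschitz_on UNIV \<phi>"
proof (rule lipschitz_onI)
  have ne: "{C. C-lipschitz_on UNIV \<phi>} \<noteq> {}" using assms by auto
  show "0 \<le> lip_norm \<phi>"
    unfolding lip_norm_def by (rule cInf_greatest[OF ne]) (auto simp: lipschitz_on_def)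
  fix x y
  show "dist (\<phi> x) (\<phi> y) \<le> lip_norm \<phi> * dist x y"
  proof (cases "x = y")
    case False
    have "dist (\<phi> x) (\<phi> y) / dist x y \<le> lip_norm \<phi>"
      unfolding lip_norm_def using False
      by (intro cInf_greatest[OF ne]) (auto simp: lipschitz_on_def divide_simps)
    with False show ?thesis by (simp add: divide_simps)
  qed simp
qed

lemma lip_norm_le:
  fixes \<phi> :: "'a::metric_space \<Rightarrow> 'k::real_normed_field"
  assumes "C-lipschitz_on UNIV \<phi>"
  shows "lip_norm \<phi> \<le> C"
  unfolding lip_norm_def
  by (rule cInf_lower) (use assms in \<open>auto simp: lipschitz_on_def intro!: bdd_belowI[of _ 0]\<close>)

lemma lip0_lipschitz: "\<phi> \<in> lip0 e \<Longrightarrow> (lip_norm \<phi>)-lipschitz_on UNIV \<phi>"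
  by (auto simp: lip0_def intro: lip_norm_lipschitz)

lemma lip_norm_nonneg: "\<phi> \<in> lip0 e \<Longrightarrow> 0 \<le> lip_norm \<phi>"
  using lip0_lipschitz lipschitz_on_nonneg by blast

lemma lipschitz_on_scale_fun:
  fixes \<phi> :: "'a::metric_space \<Rightarrow> 'k::real_normed_field"
  assumes "C-lipschitz_on UNIV \<phi>"
  shows "(norm c * C)-lipschitz_on UNIV (scale_fun c \<phi>)"
  using assms
  by (auto simp: lipschitz_on_def scale_fun_def dist_norm norm_mult mult.assoc
      right_diff_distrib[symmetric] intro!: mult_left_mono)

lemma subspace_lip0:
  "fun_vs.subspace (lip0 e :: ('a::metric_space \<Rightarrow> 'k::real_normed_field) set)"
proof (rule fun_vs.subspaceI)
  show "0 \<in> lip0 e" by (auto simp: lip0_def lipschitz_on_def)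
next
  fix \<phi> \<psi> :: "'a \<Rightarrow> 'k" assume "\<phi> \<in> lip0 e" "\<psi> \<in> lip0 e"
  then show "\<phi> + \<psi> \<in> lip0 e"
    by (auto simp: lip0_def plus_fun_def intro: lipschitz_on_add)
next
  fix c and \<phi> :: "'a \<Rightarrow> 'k" assume "\<phi> \<in> lip0 e"
  then show "scale_fun c \<phi> \<in> lip0 e"
    unfolding lip0_def using lipschitz_on_scale_fun by (auto simp: scale_fun_def)
qed

lemma dual_bdd_above:
  assumes "\<mu> \<in> lip0_dual e"
  shows "bdd_above ((\<lambda>\<phi>. norm (\<mu> \<phi>)) ` {\<phi>\<in>lip0 e. lip_norm \<phi> \<le> 1})"
proof -
  obtain B where B: "\<forall>\<phi>\<in>lip0 e. norm (\<mu> \<phi>) \<le> B * lip_norm \<phi>"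
    using assms by (auto simp: lip0_dual_def)
  have "norm (\<mu> \<phi>) \<le> \<bar>B\<bar>" if "\<phi> \<in> lip0 e" "lip_norm \<phi> \<le> 1" for \<phi>
  proof -
    have "norm (\<mu> \<phi>) \<le> B * lip_norm \<phi>" using B that by auto
    also have "\<dots> \<le> \<bar>B\<bar> * 1"
      using that lip_norm_nonneg[of \<phi> e] by (intro mult_mono) auto
    finally show ?thesis by simp
  qed
  then show ?thesis by (auto intro!: bdd_aboveI[of _ "\<bar>B\<bar>"])
qed

lemma dual_norm_bound:
  assumes \<mu>: "\<mu> \<in> lip0_dual e" and \<phi>: "\<phi> \<in> lip0 e"
  shows "norm (\<mu> \<phi>) \<le> dual_norm e \<mu> * lip_norm \<phi>"
proof -
  let ?L = "lip_norm \<phi>"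
  obtain B where B: "\<forall>\<phi>\<in>lip0 e. norm (\<mu> \<phi>) \<le> B * lip_norm \<phi>"
    using \<mu> by (auto simp: lip0_dual_def)
  have L0: "0 \<le> ?L" using lip_norm_nonneg[OF \<phi>] .
  show ?thesis
  proof (cases "?L = 0")
    case True
    then show ?thesis using B \<phi> by fastforce
  next
    case False
    define \<psi> where "\<psi> = scale_fun (of_real (1 / ?L)) \<phi>"
    have \<psi>: "\<psi> \<in> lip0 e" unfolding \<psi>_def by (rule fun_vs.subspace_scale[OF subspace_lip0 \<phi>])
    have "lip_norm \<psi> \<le> norm (of_real (1 / ?L) :: 'b) * ?L"
      unfolding \<psi>_def by (intro lip_norm_le lipschitz_on_scale_fun lip0_lipschitz[OF \<phi>])
    also have "\<dots> = 1" using False L0 by (simp add: norm_divide)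
    finally have "norm (\<mu> \<psi>) \<le> dual_norm e \<mu>"
      unfolding dual_norm_def using \<psi> by (intro cSUP_upper dual_bdd_above[OF \<mu>]) auto
    moreover have "\<mu> \<psi> = of_real (1 / ?L) * \<mu> \<phi>"
      using \<mu> \<phi> unfolding \<psi>_def lip0_dual_def linear_on_carrier_def by auto
    ultimately show ?thesis using False L0 by (simp add: norm_mult norm_divide divide_simps)
  qed
qed

lemma dual_norm_le:
  assumes "\<And>\<phi>. \<phi> \<in> lip0 e \<Longrightarrow> lip_norm \<phi> \<le> 1 \<Longrightarrow> norm (\<mu> \<phi>) \<le> B"
  shows "dual_norm e \<mu> \<le> B"
  unfolding dual_norm_def
proof (rule cSUP_least)
  have "lip_norm (0 :: 'a \<Rightarrow> 'b) \<le> 0" by (rule lip_norm_le) (auto simp: lipschitz_on_def)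
  then have "0 \<in> {\<phi> \<in> lip0 e. lip_norm (\<phi> :: 'a \<Rightarrow> 'b) \<le> 1}"
    using fun_vs.subspace_0[OF subspace_lip0] by auto
  then show "{\<phi> \<in> lip0 e. lip_norm (\<phi> :: 'a \<Rightarrow> 'b) \<le> 1} \<noteq> {}" by blast
qed (use assms in auto)

lemma dual_norm_nonneg: "\<mu> \<in> lip0_dual e \<Longrightarrow> 0 \<le> dual_norm e \<mu>"
proof -
  assume \<mu>: "\<mu> \<in> lip0_dual e"
  have "lip_norm (0 :: 'a \<Rightarrow> 'b) \<le> 0" by (rule lip_norm_le) (auto simp: lipschitz_on_def)
  then have "norm (\<mu> 0) \<le> dual_norm e \<mu>"
    unfolding dual_norm_def using fun_vs.subspace_0[OF subspace_lip0]
    by (intro cSUP_upper[OF _ dual_bdd_above[OF \<mu>]]) (auto simp del: zero_fun_apply)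
  then show ?thesis using norm_ge_zero order_trans by blast
qed

lemma subspace_lip0_dual:
  "fun_vs.subspace (lip0_dual e :: (('a::metric_space \<Rightarrow> 'k::real_normed_field) \<Rightarrow> 'k) set)"
proof (rule fun_vs.subspaceI)
  show "0 \<in> lip0_dual e"
    by (auto simp: lip0_dual_def linear_on_carrier_def intro!: exI[of _ 0])
next
  fix \<mu> \<nu> :: "('a \<Rightarrow> 'k) \<Rightarrow> 'k" assume *: "\<mu> \<in> lip0_dual e" "\<nu> \<in> lip0_dual e"
  have "norm ((\<mu> + \<nu>) \<phi>) \<le> (dual_norm e \<mu> + dual_norm e \<nu>) * lip_norm \<phi>" if "\<phi> \<in> lip0 e" for \<phi>
    using dual_norm_bound[OF *(1) that] dual_norm_bound[OF *(2) that]
      norm_triangle_ineq[of "\<mu> \<phi>" "\<nu> \<phi>"] by (simp add: distrib_right)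
  then show "\<mu> + \<nu> \<in> lip0_dual e"
    using * by (auto simp: lip0_dual_def linear_on_carrier_def distrib_left simp del: plus_fun_apply)
      (auto simp: algebra_simps)
next
  fix c and \<mu> :: "('a \<Rightarrow> 'k) \<Rightarrow> 'k" assume *: "\<mu> \<in> lip0_dual e"
  have "norm (scale_fun c \<mu> \<phi>) \<le> (norm c * dual_norm e \<mu>) * lip_norm \<phi>" if "\<phi> \<in> lip0 e" for \<phi>
    using dual_norm_bound[OF * that]
    by (simp add: scale_fun_def norm_mult mult.assoc mult_left_mono)
  then have "\<exists>B. \<forall>\<phi>\<in>lip0 e. norm (scale_fun c \<mu> \<phi>) \<le> B * lip_norm \<phi>" by blast
  moreover have "linear_on_carrier scale_fun (*) (lip0 e) (scale_fun c \<mu>)"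
    using * unfolding lip0_dual_def linear_on_carrier_def
    by (auto simp: scale_fun_def[of c \<mu>] algebra_simps)
  moreover have "\<phi> \<notin> lip0 e \<Longrightarrow> scale_fun c \<mu> \<phi> = 0" for \<phi>
    using * by (auto simp: lip0_dual_def scale_fun_def)
  ultimately show "scale_fun c \<mu> \<in> lip0_dual e" by (auto simp: lip0_dual_def)
qed

lemma dual_norm_add:
  assumes "\<mu> \<in> lip0_dual e" "\<nu> \<in> lip0_dual e"
  shows "dual_norm e (\<mu> + \<nu>) \<le> dual_norm e \<mu> + dual_norm e \<nu>"
proof (rule dual_norm_le)
  fix \<phi> :: "'a \<Rightarrow> 'b" assume \<phi>: "\<phi> \<in> lip0 e" "lip_norm \<phi> \<le> 1"
  have "norm (\<mu> \<phi>) \<le> dual_norm e \<mu>" "norm (\<nu> \<phi>) \<le> dual_norm e \<nu>"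
    unfolding dual_norm_def using \<phi> assms by (auto intro!: cSUP_upper dual_bdd_above)
  then show "norm ((\<mu> + \<nu>) \<phi>) \<le> dual_norm e \<mu> + dual_norm e \<nu>"
    using norm_triangle_ineq[of "\<mu> \<phi>" "\<nu> \<phi>"] by simp
qed

lemma dual_norm_minus_commute:
  fixes \<mu> \<nu> :: "('a::metric_space \<Rightarrow> 'k::real_normed_field) \<Rightarrow> 'k"
  shows "dual_norm e (\<mu> - \<nu>) = dual_norm e (\<nu> - \<mu>)"
  unfolding dual_norm_def by (simp add: norm_minus_commute)

lemma dual_norm_eq_0:
  assumes "\<mu> \<in> lip0_dual e" "dual_norm e \<mu> \<le> 0"
  shows "\<mu> = 0"
proof
  fix \<phi>
  show "\<mu> \<phi> = 0 \<phi>"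
  proof (cases "\<phi> \<in> lip0 e")
    case True
    then have "norm (\<mu> \<phi>) \<le> 0"
      using dual_norm_bound[OF assms(1) True] assms(2) lip_norm_nonneg[OF True]
      by (meson mult_nonpos_nonneg order_trans)
    then show ?thesis by simp
  next
    case False
    then show ?thesis using assms(1) by (auto simp: lip0_dual_def)
  qed
qed

lemma dual_norm_0: "dual_norm e 0 = 0"
  by (rule antisym[OF dual_norm_le dual_norm_nonneg]) (auto simp: fun_vs.subspace_0 subspace_lip0_dual)

interpretation dual: Metric_space
    "lip0_dual e :: (('a::metric_space \<Rightarrow> 'k::real_normed_field) \<Rightarrow> 'k) set" "dual_dist e"
  rewrites "Metric_space.mtopology (lip0_dual e) (dual_dist e) = dual_topology e"
    for e :: "'a::metric_space"
proof -
  show "Metric_space (lip0_dual e :: (('a \<Rightarrow> 'k) \<Rightarrow> 'k) set) (dual_dist e)"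
  proof
    note diff = fun_vs.subspace_diff[OF subspace_lip0_dual]
    fix \<mu> \<nu> \<rho> :: "('a \<Rightarrow> 'k) \<Rightarrow> 'k"
    show "0 \<le> dual_dist e \<mu> \<nu>" by (auto simp: dual_dist_def dual_norm_nonneg diff)
    show "dual_dist e \<mu> \<nu> = dual_dist e \<nu> \<mu>"
      by (auto simp: dual_dist_def dual_norm_minus_commute)
    assume \<mu>: "\<mu> \<in> lip0_dual e" and \<nu>: "\<nu> \<in> lip0_dual e"
    show "dual_dist e \<mu> \<nu> = 0 \<longleftrightarrow> \<mu> = \<nu>"
      using dual_norm_eq_0[OF diff[OF \<mu> \<nu>]] \<mu> \<nu> by (auto simp: dual_dist_def dual_norm_0)
    assume \<rho>: "\<rho> \<in> lip0_dual e"
    have "dual_norm e ((\<mu> - \<nu>) + (\<nu> - \<rho>)) \<le> dual_norm e (\<mu> - \<nu>) + dual_norm e (\<nu> - \<rho>)"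
      by (intro dual_norm_add diff \<mu> \<nu> \<rho>)
    then show "dual_dist e \<mu> \<rho> \<le> dual_dist e \<mu> \<nu> + dual_dist e \<nu> \<rho>"
      using \<mu> \<nu> \<rho> by (simp add: dual_dist_def)
  qed
qed (simp add: dual_topology_def)

lemma delta_in_lip0_dual: "delta e x \<in> lip0_dual e"
proof -
  have "norm (\<phi> x) \<le> dist x e * lip_norm \<phi>" if "\<phi> \<in> lip0 e" for \<phi> :: "'a \<Rightarrow> 'b"
    using lipschitz_onD[OF lip0_lipschitz[OF that], of x e] that
    by (simp add: lip0_def mult.commute)
  moreover have "linear_on_carrier scale_fun (*) (lip0 e) (delta e x :: ('a \<Rightarrow> 'b) \<Rightarrow> 'b)"
    by (simp add: linear_on_carrier_def delta_def fun_vs.subspace_add[OF subspace_lip0]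
        fun_vs.subspace_scale[OF subspace_lip0]) (simp add: scale_fun_def)
  ultimately show ?thesis unfolding lip0_dual_def by (auto simp: delta_def)
qed

lemma free_space_iff:
  "\<mu> \<in> free_space e \<longleftrightarrow> \<mu> \<in> lip0_dual e \<and>
    (\<forall>r>0. \<exists>\<nu>\<in>fun_vs.span (range (delta e)). dual_norm e (\<mu> - \<nu>) < r)"
proof -
  have "fun_vs.span (range (delta e)) \<subseteq> (lip0_dual e :: (('a \<Rightarrow> 'b) \<Rightarrow> 'b) set)"
    by (rule fun_vs.span_minimal) (auto simp: delta_in_lip0_dual subspace_lip0_dual)
  then show ?thesis
    unfolding free_space_def dual.metric_closure_of by (auto simp: dual_dist_def) blast
qed

lemma span_subset_free_space: "fun_vs.span (range (delta e)) \<subseteq> free_space e"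
proof
  fix \<mu> assume \<mu>: "\<mu> \<in> fun_vs.span (range (delta e))"
  have "fun_vs.span (range (delta e)) \<subseteq> lip0_dual e"
    by (rule fun_vs.span_minimal) (auto simp: delta_in_lip0_dual subspace_lip0_dual)
  with \<mu> show "\<mu> \<in> free_space e" unfolding free_space_iff by (auto simp: dual_norm_0 intro!: bexI[of _ \<mu>])
qed

lemma dual_norm_scale:
  assumes "\<mu> \<in> lip0_dual e"
  shows "dual_norm e (scale_fun c \<mu>) \<le> norm c * dual_norm e \<mu>"
proof (rule dual_norm_le)
  fix \<phi> :: "'a \<Rightarrow> 'b" assume "\<phi> \<in> lip0 e" "lip_norm \<phi> \<le> 1"
  then have "norm (\<mu> \<phi>) \<le> dual_norm e \<mu>"
    unfolding dual_norm_def using assms by (auto intro!: cSUP_upper dual_bdd_above)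
  then show "norm (scale_fun c \<mu> \<phi>) \<le> norm c * dual_norm e \<mu>"
    by (simp add: scale_fun_def norm_mult mult_left_mono)
qed

lemma subspace_free_space:
  "fun_vs.subspace (free_space e :: (('a::metric_space \<Rightarrow> 'k::real_normed_field) \<Rightarrow> 'k) set)"
proof (rule fun_vs.subspaceI)
  show "0 \<in> free_space e" using span_subset_free_space fun_vs.span_zero by blast
next
  fix \<mu> \<nu> :: "('a \<Rightarrow> 'k) \<Rightarrow> 'k" assume *: "\<mu> \<in> free_space e" "\<nu> \<in> free_space e"
  then have D: "\<mu> \<in> lip0_dual e" "\<nu> \<in> lip0_dual e" by (auto simp: free_space_iff)
  have "\<exists>\<rho>\<in>fun_vs.span (range (delta e)). dual_norm e ((\<mu> + \<nu>) - \<rho>) < r" if "r > 0" for r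
  proof -
    have "r / 2 > 0" using that by simp
    with * obtain \<mu>' \<nu>' where m: "\<mu>' \<in> fun_vs.span (range (delta e))" "dual_norm e (\<mu> - \<mu>') < r / 2"
        "\<nu>' \<in> fun_vs.span (range (delta e))" "dual_norm e (\<nu> - \<nu>') < r / 2"
      unfolding free_space_iff by blast
    then have "\<mu>' \<in> lip0_dual e" "\<nu>' \<in> lip0_dual e"
      using span_subset_free_space free_space_iff by blast+
    then have "dual_norm e ((\<mu> - \<mu>') + (\<nu> - \<nu>')) < r"
      using dual_norm_add[of "\<mu> - \<mu>'" e "\<nu> - \<nu>'"] D m
      by (fastforce intro: fun_vs.subspace_diff[OF subspace_lip0_dual])
    then show ?thesis using m by (intro bexI[of _ "\<mu>' + \<nu>'"]) (auto simp: algebra_simps fun_vs.span_add)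
  qed
  then show "\<mu> + \<nu> \<in> free_space e"
    using D by (auto simp: free_space_iff fun_vs.subspace_add[OF subspace_lip0_dual])
next
  fix c and \<mu> :: "('a \<Rightarrow> 'k) \<Rightarrow> 'k" assume *: "\<mu> \<in> free_space e"
  then have D: "\<mu> \<in> lip0_dual e" by (auto simp: free_space_iff)
  have "\<exists>\<rho>\<in>fun_vs.span (range (delta e)). dual_norm e (scale_fun c \<mu> - \<rho>) < r" if "r > 0" for r
  proof -
    have "r / (norm c + 1) > 0" using that by (simp add: add_nonneg_pos)
    with * obtain \<mu>' where m: "\<mu>' \<in> fun_vs.span (range (delta e))" "dual_norm e (\<mu> - \<mu>') < r / (norm c + 1)"
      unfolding free_space_iff by blast
    then have D': "\<mu> - \<mu>' \<in> lip0_dual e"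
      using span_subset_free_space free_space_iff D fun_vs.subspace_diff[OF subspace_lip0_dual] by blast
    have "dual_norm e (scale_fun c (\<mu> - \<mu>')) \<le> norm c * dual_norm e (\<mu> - \<mu>')"
      by (rule dual_norm_scale[OF D'])
    also have "\<dots> \<le> (norm c + 1) * dual_norm e (\<mu> - \<mu>')"
      using dual_norm_nonneg[OF D'] by (intro mult_right_mono) auto
    also have "\<dots> < r" using m(2) by (simp add: pos_less_divide_eq add_nonneg_pos mult.commute)
    finally show ?thesis using m
      by (intro bexI[of _ "scale_fun c \<mu>'"]) (auto simp: fun_vs.scale_right_diff_distrib fun_vs.span_scale)
  qed
  then show "scale_fun c \<mu> \<in> free_space e"
    using D by (auto simp: free_space_iff fun_vs.subspace_scale[OF subspace_lip0_dual])
qed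

lemma lip0_pullback:
  assumes f: "L-lipschitz_on UNIV f" and \<phi>: "\<phi> \<in> lip0 e"
  shows "(\<lambda>x. \<phi> (f x) - \<phi> (f e)) \<in> lip0 e"
    and "lip_norm (\<lambda>x. \<phi> (f x) - \<phi> (f e)) \<le> L * lip_norm \<phi>"
proof -
  have "(lip_norm \<phi> * L)-lipschitz_on UNIV (\<lambda>x. \<phi> (f x))"
    using lipschitz_on_compose2[OF f lipschitz_on_subset[OF lip0_lipschitz[OF \<phi>]]] by auto
  then have *: "(L * lip_norm \<phi>)-lipschitz_on UNIV (\<lambda>x. \<phi> (f x) - \<phi> (f e))"
    by (simp add: lipschitz_on_def mult.commute dist_norm)
  then show "(\<lambda>x. \<phi> (f x) - \<phi> (f e)) \<in> lip0 e" by (auto simp: lip0_def)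
  show "lip_norm (\<lambda>x. \<phi> (f x) - \<phi> (f e)) \<le> L * lip_norm \<phi>" by (rule lip_norm_le[OF *])
qed

lemma free_operator_exists:
  fixes f :: "'a::metric_space \<Rightarrow> 'a"
  assumes f: "L-lipschitz_on UNIV f"
  shows "\<exists>T :: (('a \<Rightarrow> 'k::real_normed_field) \<Rightarrow> 'k) \<Rightarrow> (('a \<Rightarrow> 'k) \<Rightarrow> 'k). is_free_operator f e T"
proof -
  define p where "p \<phi> = (\<lambda>x. \<phi> (f x) - \<phi> (f e))" for \<phi> :: "'a \<Rightarrow> 'k"
  define A where "A \<mu> = (\<lambda>\<phi>. if \<phi> \<in> lip0 e then \<mu> (p \<phi>) else 0)" for \<mu> :: "('a \<Rightarrow> 'k) \<Rightarrow> 'k"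
  define T where "T \<mu> = (if \<mu> \<in> free_space e then A \<mu> else 0)" for \<mu> :: "('a \<Rightarrow> 'k) \<Rightarrow> 'k"
  have L0: "0 \<le> L" using f lipschitz_on_nonneg by blast
  have p: "p \<phi> \<in> lip0 e" "lip_norm (p \<phi>) \<le> L * lip_norm \<phi>" if "\<phi> \<in> lip0 e" for \<phi>
    unfolding p_def by (rule lip0_pullback[OF f that])+
  have p_lin: "p (\<phi> + \<psi>) = p \<phi> + p \<psi>" "p (scale_fun c \<phi>) = scale_fun c (p \<phi>)" for \<phi> \<psi> c
    by (auto simp: p_def scale_fun_def algebra_simps fun_eq_iff)
  have A_lin: "A (\<mu> + \<nu>) = A \<mu> + A \<nu>" "A (scale_fun c \<mu>) = scale_fun c (A \<mu>)" "A 0 = 0"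
      "A (\<mu> - \<nu>) = A \<mu> - A \<nu>" for \<mu> \<nu> c
    by (auto simp: A_def scale_fun_def fun_eq_iff)
  have A_bound: "norm (A \<mu> \<phi>) \<le> L * dual_norm e \<mu> * lip_norm \<phi>"
    if "\<mu> \<in> lip0_dual e" "\<phi> \<in> lip0 e" for \<mu> \<phi>
  proof -
    have "norm (A \<mu> \<phi>) \<le> dual_norm e \<mu> * lip_norm (p \<phi>)"
      using that by (simp add: A_def dual_norm_bound p)
    also have "\<dots> \<le> dual_norm e \<mu> * (L * lip_norm \<phi>)"
      using that by (intro mult_left_mono p dual_norm_nonneg)
    finally show ?thesis by (simp add: mult_ac)
  qed
  have A_dual: "A \<mu> \<in> lip0_dual e" if "\<mu> \<in> lip0_dual e" for \<mu>
  proof -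
    have "linear_on_carrier scale_fun (*) (lip0 e) (A \<mu>)"
      using that by (auto simp: linear_on_carrier_def A_def lip0_dual_def p p_lin
          fun_vs.subspace_add[OF subspace_lip0] fun_vs.subspace_scale[OF subspace_lip0])
    then show ?thesis using A_bound[OF that] by (auto simp: lip0_dual_def A_def)
  qed
  have A_norm: "dual_norm e (A \<mu>) \<le> L * dual_norm e \<mu>" if "\<mu> \<in> lip0_dual e" for \<mu>
  proof (rule dual_norm_le)
    fix \<phi> :: "'a \<Rightarrow> 'k" assume \<phi>: "\<phi> \<in> lip0 e" "lip_norm \<phi> \<le> 1"
    have "norm (A \<mu> \<phi>) \<le> L * dual_norm e \<mu> * lip_norm \<phi>" by (rule A_bound[OF that \<phi>(1)])
    also have "\<dots> \<le> L * dual_norm e \<mu> * 1"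
      using \<phi> L0 dual_norm_nonneg[OF that] by (intro mult_left_mono) auto
    finally show "norm (A \<mu> \<phi>) \<le> L * dual_norm e \<mu>" by simp
  qed
  have A_delta: "A (delta e x) = delta e (f x) - delta e (f e)" for x
    using p by (auto simp: A_def delta_def fun_eq_iff) (simp add: p_def)
  have A_span: "A \<mu> \<in> fun_vs.span (range (delta e))" if "\<mu> \<in> fun_vs.span (range (delta e))" for \<mu>
    using that
  proof (induction rule: fun_vs.span_induct)
    case base
    show ?case
      by (rule fun_vs.subspaceI) (auto simp: A_lin fun_vs.span_zero fun_vs.span_add fun_vs.span_scale)
  next
    case (step \<mu>)
    then obtain x where "\<mu> = delta e x" by blast
    then show ?case by (simp only: A_delta) (intro fun_vs.span_diff fun_vs.span_base rangeI)
  qed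
  have A_free: "A \<mu> \<in> free_space e" if "\<mu> \<in> free_space e" for \<mu>
  proof -
    have D: "\<mu> \<in> lip0_dual e" using that by (simp add: free_space_iff)
    have "\<exists>\<nu>\<in>fun_vs.span (range (delta e)). dual_norm e (A \<mu> - \<nu>) < r" if "r > 0" for r
    proof -
      have "r / (L + 1) > 0" using that L0 by simp
      with \<open>\<mu> \<in> free_space e\<close> obtain \<nu> where \<nu>: "\<nu> \<in> fun_vs.span (range (delta e))"
          "dual_norm e (\<mu> - \<nu>) < r / (L + 1)"
        unfolding free_space_iff by blast
      then have D': "\<mu> - \<nu> \<in> lip0_dual e"
        using span_subset_free_space free_space_iff D fun_vs.subspace_diff[OF subspace_lip0_dual] by blast
      have "dual_norm e (A \<mu> - A \<nu>) \<le> L * dual_norm e (\<mu> - \<nu>)"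
        using A_norm[OF D'] by (simp add: A_lin)
      also have "\<dots> \<le> (L + 1) * dual_norm e (\<mu> - \<nu>)"
        using dual_norm_nonneg[OF D'] by (intro mult_right_mono) auto
      also have "\<dots> < r" using \<nu>(2) L0 by (simp add: pos_less_divide_eq mult.commute)
      finally show ?thesis using A_span[OF \<nu>(1)] by blast
    qed
    then show ?thesis using A_dual[OF D] by (auto simp: free_space_iff)
  qed
  have "is_free_operator f e T"
    unfolding is_free_operator_def bounded_operator_on_free_space_def linear_on_carrier_def
  proof (intro conjI)
    show "T ` free_space e \<subseteq> free_space e" by (auto simp: T_def A_free)
    show "\<forall>u\<in>free_space e. \<forall>v\<in>free_space e. T (u + v) = T u + T v"
      using fun_vs.subspace_add[OF subspace_free_space] by (auto simp: T_def A_lin)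
    show "\<forall>c. \<forall>u\<in>free_space e. T (scale_fun c u) = scale_fun c (T u)"
      using fun_vs.subspace_scale[OF subspace_free_space] by (auto simp: T_def A_lin)
    show "\<exists>B. \<forall>\<mu>\<in>free_space e. dual_norm e (T \<mu>) \<le> B * dual_norm e \<mu>"
      using A_norm by (intro exI[of _ L]) (auto simp: T_def free_space_iff)
    show "\<forall>x. T (delta e x) = delta e (f x) - delta e (f e)"
      using span_subset_free_space[of e] fun_vs.span_base[of _ "range (delta e)"]
      by (auto simp: T_def A_delta)
    show "\<forall>\<mu>. \<mu> \<notin> free_space e \<longrightarrow> T \<mu> = 0" by (simp add: T_def)
  qed
  then show ?thesis by blast
qed

lemma free_operator_unique:
  fixes f :: "'a::metric_space \<Rightarrow> 'a"
    and T U :: "(('a \<Rightarrow> 'k::real_normed_field) \<Rightarrow> 'k) \<Rightarrow> (('a \<Rightarrow> 'k) \<Rightarrow> 'k)"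
  assumes T: "is_free_operator f e T" and U: "is_free_operator f e U"
  shows "T = U"
proof
  fix \<mu>
  note free_add = fun_vs.subspace_add[OF subspace_free_space]
    and free_scale = fun_vs.subspace_scale[OF subspace_free_space]
    and free_diff = fun_vs.subspace_diff[OF subspace_free_space]
  show "T \<mu> = U \<mu>"
  proof (cases "\<mu> \<in> free_space e")
    case False
    then show ?thesis using T U by (simp add: is_free_operator_def)
  next
    case True
    obtain B1 where B1: "\<forall>\<mu>\<in>free_space e. dual_norm e (T \<mu>) \<le> B1 * dual_norm e \<mu>"
      using T unfolding is_free_operator_def bounded_operator_on_free_space_def by blast
    obtain B2 where B2: "\<forall>\<mu>\<in>free_space e. dual_norm e (U \<mu>) \<le> B2 * dual_norm e \<mu>"
      using U unfolding is_free_operator_def bounded_operator_on_free_space_def by blast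
    have add: "T (u + v) = T u + T v" "U (u + v) = U u + U v"
      if "u \<in> free_space e" "v \<in> free_space e" for u v
      using T U that
      by (auto simp: is_free_operator_def bounded_operator_on_free_space_def linear_on_carrier_def)
    have scale: "T (scale_fun c u) = scale_fun c (T u)" "U (scale_fun c u) = scale_fun c (U u)"
      if "u \<in> free_space e" for c u
      using T U that
      by (auto simp: is_free_operator_def bounded_operator_on_free_space_def linear_on_carrier_def)
    have maps: "T u \<in> free_space e" "U u \<in> free_space e" if "u \<in> free_space e" for u
      using T U that by (auto simp: is_free_operator_def bounded_operator_on_free_space_def)
    have eq: "\<nu> \<in> free_space e \<and> T \<nu> = U \<nu>" if "\<nu> \<in> fun_vs.span (range (delta e))" for \<nu>
      using that
    proof (induction rule: fun_vs.span_induct)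
      case base
      have "T 0 = 0" "U 0 = 0"
        using scale[of 0 0] fun_vs.subspace_0[OF subspace_free_space[of e]]
        by (auto simp: scale_fun_def zero_fun_def)
      then show ?case
        by (intro fun_vs.subspaceI)
          (auto simp: add scale free_add free_scale fun_vs.subspace_0[OF subspace_free_space])
    next
      case (step \<nu>)
      then have "\<nu> \<in> free_space e"
        using span_subset_free_space[of e] fun_vs.span_base[of \<nu> "range (delta e)"] by blast
      then show ?case using step T U by (auto simp: is_free_operator_def)
    qed
    have D: "T \<mu> - U \<mu> \<in> lip0_dual e" using free_diff maps[OF True] free_space_iff by blast
    have "dual_norm e (T \<mu> - U \<mu>) \<le> 0 + r" if r: "r > 0" for r
    proof -
      define B where "B = \<bar>B1\<bar> + \<bar>B2\<bar> + 1"
      have B: "B > 0" by (simp add: B_def)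
      with r have "r / B > 0" by simp
      with True obtain \<nu> where \<nu>: "\<nu> \<in> fun_vs.span (range (delta e))" "dual_norm e (\<mu> - \<nu>) < r / B"
        unfolding free_space_iff by blast
      let ?d = "\<mu> - \<nu>"
      have d: "?d \<in> free_space e" using free_diff True eq[OF \<nu>(1)] by blast
      then have d0: "0 \<le> dual_norm e ?d" using dual_norm_nonneg free_space_iff by blast
      have "T (?d + \<nu>) = T ?d + T \<nu>" "U (?d + \<nu>) = U ?d + U \<nu>" by (intro add d; use eq[OF \<nu>(1)] in blast)+
      then have "T \<mu> - U \<mu> = T ?d - U ?d" using eq[OF \<nu>(1)] by simp
      also have "\<dots> = T ?d + scale_fun (-1) (U ?d)" by (simp add: scale_fun_def fun_eq_iff)
      finally have "dual_norm e (T \<mu> - U \<mu>) = dual_norm e (T ?d + scale_fun (-1) (U ?d))" by simp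
      also have "\<dots> \<le> dual_norm e (T ?d) + dual_norm e (scale_fun (-1) (U ?d))"
        by (intro dual_norm_add; use maps[OF d] free_scale free_space_iff in blast)
      also have "\<dots> \<le> dual_norm e (T ?d) + dual_norm e (U ?d)"
        using dual_norm_scale[of "U ?d" e "-1"] maps[OF d] by (simp add: free_space_iff)
      also have "\<dots> \<le> B1 * dual_norm e ?d + B2 * dual_norm e ?d" using B1 B2 d by (intro add_mono) auto
      also have "\<dots> = (B1 + B2) * dual_norm e ?d" by (simp add: distrib_right)
      also have "\<dots> \<le> B * dual_norm e ?d" using d0 by (intro mult_right_mono) (auto simp: B_def)
      also have "\<dots> \<le> r" using \<nu>(2) B by (simp add: pos_less_divide_eq mult.commute)
      finally show ?thesis by simp
    qed
    then have "dual_norm e (T \<mu> - U \<mu>) \<le> 0" by (rule field_le_epsilon)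
    then show ?thesis using dual_norm_eq_0[OF D] by simp
  qed
qed

lemma ex1_free_operator:
  assumes "L-lipschitz_on UNIV f"
  shows "\<exists>!T. is_free_operator f e T"
  using free_operator_exists[OF assms] free_operator_unique by blast

end

theory Submission
  imports Defs
begin

text \<open>
  A Lipschitz map \<open>f\<close> sends connected components into connected components, so composition with
  \<open>f\<close> preserves the Lipschitz functions that are constant on components, and the pre-annihilator in
  the free space of these functions is invariant.  It contains \<open>\<delta>(x) - \<delta>(y)\<close> for \<open>x \<noteq> y\<close> in a
  common component.  It does not contain \<open>\<delta>(x) - \<delta>(y)\<close> for \<open>x \<in> S\<close>, \<open>y \<notin> S\<close>, because the positive
  distance makes the indicator function of \<open>S\<close> Lipschitz, hence continuous with discrete range, so
  constant on components.
\<close>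

section \<open>Functionals and operators on the free space\<close>

lemma delta_in_free_space: "delta e x \<in> free_space e"
  using span_subset_free_space fun_vs.span_base by blast

lemma free_space_subset_lip0_dual: "\<mu> \<in> free_space e \<Longrightarrow> \<mu> \<in> lip0_dual e"
  by (simp add: free_space_iff)

lemma delta_diff_in_free_space: "delta e x - delta e y \<in> free_space e"
  by (intro fun_vs.subspace_diff subspace_free_space delta_in_free_space)

text \<open>By linearity \<open>F\<close> vanishes on the span of the evaluations; this span is
  dense in the free space and \<open>F\<close> is continuous. Applied to a difference, the lemma
  shows that two functionals agree once they agree at every \<open>delta e x\<close>.\<close>

lemma free_space_functional_eq_0:
  fixes F :: "(('a::metric_space \<Rightarrow> 'k::real_normed_field) \<Rightarrow> 'k) \<Rightarrow> 'k"
  assumes lin: "linear_on_carrier scale_fun (*) (free_space e) F"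
    and bound: "\<And>\<mu>. \<mu> \<in> free_space e \<Longrightarrow> norm (F \<mu>) \<le> B * dual_norm e \<mu>"
    and delta: "\<And>x. F (delta e x) = 0"
    and \<mu>: "\<mu> \<in> free_space e"
  shows "F \<mu> = 0"
proof -
  note free_add = fun_vs.subspace_add[OF subspace_free_space]
    and free_scale = fun_vs.subspace_scale[OF subspace_free_space]
    and free_diff = fun_vs.subspace_diff[OF subspace_free_space]
  have add: "F (u + v) = F u + F v" if "u \<in> free_space e" "v \<in> free_space e" for u v
    using lin that by (simp add: linear_on_carrier_def)
  have scale: "F (scale_fun c u) = c * F u" if "u \<in> free_space e" for c u
    using lin that by (simp add: linear_on_carrier_def)
  have F0: "F 0 = 0"
    using add[of 0 0] fun_vs.subspace_0[OF subspace_free_space[of e]] by simp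
  have span: "\<nu> \<in> free_space e \<and> F \<nu> = 0" if "\<nu> \<in> fun_vs.span (range (delta e))" for \<nu>
    using that
  proof (induction rule: fun_vs.span_induct)
    case base
    show ?case
      by (intro fun_vs.subspaceI)
        (auto simp: F0 add scale free_add free_scale fun_vs.subspace_0[OF subspace_free_space])
  next
    case (step \<nu>)
    then show ?case by (auto simp: delta delta_in_free_space)
  qed
  \<comment> \<open>The form \<open>0 + r\<close> is the one that \<open>field_le_epsilon\<close>
    expects.\<close>
  have "norm (F \<mu>) \<le> 0 + r" if r: "r > 0" for r
  proof -
    \<comment> \<open>The sign of \<open>B\<close> is unknown; \<open>\<bar>B\<bar> + 1\<close>
      dominates it and is a positive divisor.\<close>
    have "r / (\<bar>B\<bar> + 1) > 0" using r by simp
    with \<mu> obtain \<nu> where \<nu>: "\<nu> \<in> fun_vs.span (range (delta e))"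
        "dual_norm e (\<mu> - \<nu>) < r / (\<bar>B\<bar> + 1)"
      unfolding free_space_iff by blast
    have d: "\<mu> - \<nu> \<in> free_space e" using free_diff \<mu> span[OF \<nu>(1)] by blast
    have "F \<mu> = F (\<mu> - \<nu>)" using add[OF d] span[OF \<nu>(1)] by fastforce
    then have "norm (F \<mu>) \<le> B * dual_norm e (\<mu> - \<nu>)" using bound[OF d] by simp
    also have "\<dots> \<le> (\<bar>B\<bar> + 1) * dual_norm e (\<mu> - \<nu>)"
      using dual_norm_nonneg[OF free_space_subset_lip0_dual[OF d]] by (intro mult_right_mono) auto
    also have "\<dots> \<le> r" using \<nu>(2) by (simp add: pos_less_divide_eq mult.commute)
    finally show ?thesis by simp
  qed
  then have "norm (F \<mu>) \<le> 0" by (rule field_le_epsilon)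
  then show ?thesis by simp
qed

text \<open>Both sides are bounded and linear in \<open>\<mu>\<close> and agree on evaluations,
  where \<open>T\<close> is prescribed. Thus \<open>T\<close> is the transpose of the pullback along
  \<open>f\<close>, which allows \<open>T \<mu>\<close> to be tested against single
  functions.\<close>

lemma is_free_operator_apply:
  fixes f :: "'a::metric_space \<Rightarrow> 'a" and \<phi> :: "'a \<Rightarrow> 'k::real_normed_field"
  assumes f: "L-lipschitz_on UNIV f" and T: "is_free_operator f e T"
    and \<phi>: "\<phi> \<in> lip0 e" and \<mu>: "\<mu> \<in> free_space e"
  shows "T \<mu> \<phi> = \<mu> (\<lambda>x. \<phi> (f x) - \<phi> (f e))"
proof -
  define p where "p = (\<lambda>x. \<phi> (f x) - \<phi> (f e))"
  have p: "p \<in> lip0 e" unfolding p_def by (rule lip0_pullback[OF f \<phi>])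
  obtain B where B: "\<And>\<mu>. \<mu> \<in> free_space e \<Longrightarrow> dual_norm e (T \<mu>) \<le> B * dual_norm e \<mu>"
    using T unfolding is_free_operator_def bounded_operator_on_free_space_def by blast
  have maps: "T \<mu> \<in> free_space e" if "\<mu> \<in> free_space e" for \<mu>
    using T that by (auto simp: is_free_operator_def bounded_operator_on_free_space_def)
  have "T \<mu> \<phi> - \<mu> p = 0"
  proof (rule free_space_functional_eq_0[OF _ _ _ \<mu>])
    show "linear_on_carrier scale_fun (*) (free_space e) (\<lambda>\<mu>. T \<mu> \<phi> - \<mu> p)"
      using T
      by (simp add: is_free_operator_def bounded_operator_on_free_space_def linear_on_carrier_def)
        (simp add: scale_fun_def algebra_simps)
    show "T (delta e x) \<phi> - delta e x p = 0" for x
      using T \<phi> p by (simp add: is_free_operator_def delta_def) (simp add: p_def)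
    fix \<nu> :: "('a \<Rightarrow> 'k) \<Rightarrow> 'k" assume \<nu>: "\<nu> \<in> free_space e"
    have "norm (T \<nu> \<phi> - \<nu> p) \<le> norm (T \<nu> \<phi>) + norm (\<nu> p)" by (rule norm_triangle_ineq4)
    \<comment> \<open>For a fixed function, evaluating a functional at it is bounded in the dual
      norm by the function's \<open>lip_norm\<close>. Only the first term passes through
      \<open>T\<close> and picks up \<open>B\<close>.\<close>
    also have "\<dots> \<le> dual_norm e (T \<nu>) * lip_norm \<phi> + dual_norm e \<nu> * lip_norm p"
      by (intro add_mono dual_norm_bound free_space_subset_lip0_dual maps \<nu> \<phi> p)
    also have "\<dots> \<le> (B * dual_norm e \<nu>) * lip_norm \<phi> + dual_norm e \<nu> * lip_norm p"
      by (intro add_mono mult_right_mono B \<nu> lip_norm_nonneg[OF \<phi>] order_refl)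
    finally show "norm (T \<nu> \<phi> - \<nu> p) \<le> (B * lip_norm \<phi> + lip_norm p) * dual_norm e \<nu>"
      by (simp add: algebra_simps)
  qed
  then show ?thesis by (simp add: p_def)
qed

section \<open>Pre-annihilators of sets of Lipschitz functions\<close>

definition pre_annihilator ::
  "'a::metric_space \<Rightarrow> ('a \<Rightarrow> 'k::real_normed_field) set \<Rightarrow> (('a \<Rightarrow> 'k) \<Rightarrow> 'k) set"
  where "pre_annihilator e K = {\<mu> \<in> free_space e. \<forall>\<phi>\<in>K. \<mu> \<phi> = 0}"

lemma subspace_pre_annihilator: "fun_vs.subspace (pre_annihilator e K)"
proof (rule fun_vs.subspaceI)
  show "0 \<in> pre_annihilator e K"
    by (simp add: pre_annihilator_def fun_vs.subspace_0[OF subspace_free_space])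
  show "\<mu> + \<nu> \<in> pre_annihilator e K"
    if "\<mu> \<in> pre_annihilator e K" "\<nu> \<in> pre_annihilator e K" for \<mu> \<nu>
    using that by (simp add: pre_annihilator_def fun_vs.subspace_add[OF subspace_free_space])
  show "scale_fun c \<mu> \<in> pre_annihilator e K" if "\<mu> \<in> pre_annihilator e K" for c \<mu>
    using that fun_vs.subspace_scale[OF subspace_free_space, of \<mu> e c]
    unfolding pre_annihilator_def by (simp add: scale_fun_def)
qed

text \<open>Each map \<open>\<mu> \<mapsto> \<mu> \<phi>\<close> is continuous in the dual norm, so
  the common zero set \<open>?Z\<close> is closed in the whole dual; intersecting with the free
  space gives the relative statement.\<close>

lemma closedin_pre_annihilator:
  fixes K :: "('a::metric_space \<Rightarrow> 'k::real_normed_field) set"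
  assumes K: "K \<subseteq> lip0 e"
  shows "closedin (subtopology (dual_topology e) (free_space e)) (pre_annihilator e K)"
proof -
  let ?Z = "{\<mu> \<in> lip0_dual e. \<forall>\<phi>\<in>K. \<mu> \<phi> = 0}"
  have "closedin (dual_topology e) ?Z"
    unfolding dual.closedin_metric
  proof (intro conjI allI impI)
    show "?Z \<subseteq> lip0_dual e" by blast
    fix \<mu> assume \<mu>: "\<mu> \<in> lip0_dual e - ?Z"
    then obtain \<phi> where \<phi>: "\<phi> \<in> K" "\<mu> \<phi> \<noteq> 0" by blast
    then have \<phi>0: "\<phi> \<in> lip0 e" using K by blast
    have L: "lip_norm \<phi> + 1 > 0" using lip_norm_nonneg[OF \<phi>0] by simp
    \<comment> \<open>A functional at distance less than \<open>r\<close> from \<open>\<mu>\<close>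
      differs from it at \<open>\<phi>\<close> by less than \<open>norm (\<mu> \<phi>)\<close>, so
      it cannot vanish there. The \<open>+ 1\<close> makes the denominator positive without a
      separate argument that \<open>lip_norm \<phi>\<close> is nonzero.\<close>
    define r where "r = norm (\<mu> \<phi>) / (lip_norm \<phi> + 1)"
    have "r > 0" using \<phi> L by (simp add: r_def)
    moreover have "\<nu> \<phi> \<noteq> 0" if \<nu>: "\<nu> \<in> lip0_dual e" "dual_dist e \<mu> \<nu> < r" for \<nu>
    proof
      assume "\<nu> \<phi> = 0"
      have D: "\<mu> - \<nu> \<in> lip0_dual e"
        using \<mu> \<nu> fun_vs.subspace_diff[OF subspace_lip0_dual] by blast
      have "norm (\<mu> \<phi>) = norm ((\<mu> - \<nu>) \<phi>)" by (simp add: \<open>\<nu> \<phi> = 0\<close>)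
      also have "\<dots> \<le> dual_norm e (\<mu> - \<nu>) * lip_norm \<phi>" by (rule dual_norm_bound[OF D \<phi>0])
      also have "\<dots> \<le> dual_norm e (\<mu> - \<nu>) * (lip_norm \<phi> + 1)"
        using dual_norm_nonneg[OF D] by (intro mult_left_mono) auto
      also have "\<dots> < r * (lip_norm \<phi> + 1)"
        using \<mu> \<nu> L by (intro mult_strict_right_mono) (auto simp: dual_dist_def)
      also have "\<dots> = norm (\<mu> \<phi>)" using L by (simp add: r_def)
      finally show False by simp
    qed
    ultimately show "\<exists>r>0. disjnt ?Z (dual.mball e \<mu> r)"
      using \<phi> by (intro exI[of _ r]) (auto simp: disjnt_iff)
  qed
  moreover have "pre_annihilator e K = ?Z \<inter> free_space e"
    by (auto simp: pre_annihilator_def free_space_iff)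
  ultimately show ?thesis by (auto simp: closedin_subtopology)
qed

text \<open>Testing \<open>T \<mu>\<close> against \<open>\<phi>\<close> amounts to testing
  \<open>\<mu>\<close> against the pullback of \<open>\<phi>\<close>, which stays in
  \<open>K\<close>. The subtracted \<open>\<phi> (f e)\<close> makes the pullback vanish at
  \<open>e\<close> even if \<open>f\<close> moves \<open>e\<close>.\<close>

lemma pre_annihilator_invariant:
  fixes f :: "'a::metric_space \<Rightarrow> 'a"
  assumes f: "L-lipschitz_on UNIV f" and T: "is_free_operator f e T" and K: "K \<subseteq> lip0 e"
    and pullback: "\<And>\<phi>. \<phi> \<in> K \<Longrightarrow> (\<lambda>x. \<phi> (f x) - \<phi> (f e)) \<in> K"
  shows "T ` pre_annihilator e K \<subseteq> pre_annihilator e K"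
proof
  fix \<nu> assume "\<nu> \<in> T ` pre_annihilator e K"
  then obtain \<mu> where \<nu>: "\<nu> = T \<mu>" and \<mu>: "\<mu> \<in> pre_annihilator e K" by blast
  then have free: "\<mu> \<in> free_space e" by (simp add: pre_annihilator_def)
  then have "\<nu> \<in> free_space e"
    using T \<nu> by (auto simp: is_free_operator_def bounded_operator_on_free_space_def)
  moreover have "\<nu> \<phi> = 0" if "\<phi> \<in> K" for \<phi>
    using is_free_operator_apply[OF f T _ free, of \<phi>] K \<mu> pullback that
    by (auto simp: \<nu> pre_annihilator_def)
  ultimately show "\<nu> \<in> pre_annihilator e K" by (simp add: pre_annihilator_def)
qed

section \<open>Lipschitz test functions and connected components\<close>

lemma delta_diff_neq_0:
  fixes x y e :: "'a::metric_space"
  assumes "x \<noteq> y"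
  shows "(delta e x - delta e y :: ('a \<Rightarrow> 'k::real_normed_field) \<Rightarrow> 'k) \<noteq> 0"
proof
  assume *: "(delta e x - delta e y :: ('a \<Rightarrow> 'k) \<Rightarrow> 'k) = 0"
  \<comment> \<open>The distance to \<open>y\<close>, shifted to vanish at \<open>e\<close>,
    separates \<open>x\<close> from \<open>y\<close>.\<close>
  define \<phi> :: "'a \<Rightarrow> 'k" where "\<phi> z = of_real (dist z y - dist e y)" for z
  have "dist (\<phi> z) (\<phi> w) \<le> 1 * dist z w" for z w
  proof -
    have "dist (\<phi> z) (\<phi> w) = norm (of_real (dist z y - dist w y) :: 'k)"
      by (simp add: \<phi>_def dist_norm flip: of_real_diff)
    also have "\<dots> = \<bar>dist z y - dist w y\<bar>" by (rule norm_of_real)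
    also have "\<dots> \<le> dist z w" using abs_dist_diff_le[of z y w] by (simp add: dist_commute)
    finally show ?thesis by simp
  qed
  then have "1-lipschitz_on UNIV \<phi>" by (simp add: lipschitz_on_def)
  then have "\<phi> \<in> lip0 e" by (auto simp: lip0_def \<phi>_def)
  moreover have "\<phi> x - \<phi> y = of_real (dist x y)" by (simp add: \<phi>_def)
  ultimately have "(delta e x - delta e y) \<phi> = of_real (dist x y)" by (simp add: delta_def)
  with * assms show False by simp
qed

text \<open>The values differ, and then by 1, only for points on opposite sides of \<open>S\<close>,
  whose distance is at least \<open>setdist S (- S)\<close>.\<close>

lemma lipschitz_on_indicator:
  fixes S :: "'a::metric_space set"
  assumes "setdist S (- S) > 0"
  shows "(1 / setdist S (- S))-lipschitz_on UNIV (indicator S :: 'a \<Rightarrow> 'k::real_normed_field)"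
proof (rule lipschitz_onI)
  have le: "setdist S (- S) \<le> dist x y" if "x \<in> S" "y \<notin> S" for x y
    using that by (intro setdist_le_dist) auto
  show "dist (indicator S x :: 'k) (indicator S y) \<le> 1 / setdist S (- S) * dist x y" for x y
    using assms le[of x y] le[of y x]
    by (auto simp: indicator_def dist_commute[of y x] divide_simps)
qed (use assms in simp)

lemma indicator_eq_on_component:
  fixes S :: "'a::metric_space set"
  assumes S: "setdist S (- S) > 0" and xy: "connected_component UNIV x y"
  shows "(indicator S x :: 'k::real_normed_field) = indicator S y"
proof -
  obtain C where C: "connected C" "x \<in> C" "y \<in> C" using xy by (auto simp: connected_component_def)
  have "(indicator S :: 'a \<Rightarrow> 'k) constant_on C"
  proof (rule continuous_discrete_range_constant[OF \<open>connected C\<close>])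
    show "continuous_on C (indicator S :: 'a \<Rightarrow> 'k)"
      by (rule continuous_on_subset[OF lipschitz_on_continuous_on[OF lipschitz_on_indicator[OF S]]])
        simp
    \<comment> \<open>Distinct values of the indicator are 0 and 1, so a gap of 1 serves
      everywhere.\<close>
    show "\<exists>\<epsilon>>0. \<forall>w. w \<in> C \<and> (indicator S w :: 'k) \<noteq> indicator S z \<longrightarrow>
        \<epsilon> \<le> norm ((indicator S w :: 'k) - indicator S z)" for z
      by (intro exI[of _ 1]) (auto simp: indicator_def)
  qed
  then show ?thesis using C by (auto simp: constant_on_def)
qed

lemma connected_component_image:
  assumes "continuous_on UNIV f" "connected_component UNIV x y"
  shows "connected_component UNIV (f x) (f y)"
proof -
  obtain C where C: "connected C" "x \<in> C" "y \<in> C"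
    using assms(2) by (auto simp: connected_component_def)
  have "connected (f ` C)"
    using assms(1) C(1) by (metis connected_continuous_image continuous_on_subset subset_UNIV)
  with C show ?thesis by (auto simp: connected_component_def)
qed

section \<open>The invariant subspace\<close>

text \<open>The pair \<open>a\<close>, \<open>b\<close> yields a nonzero element of the subspace,
  the pair \<open>u\<close>, \<open>v\<close> an element of the free space outside it.\<close>

lemma free_operator_invariant_subspace:
  fixes e a b u v :: "'a::metric_space" and f :: "'a \<Rightarrow> 'a"
  assumes f: "L-lipschitz_on UNIV f"
    and ab: "connected_component UNIV a b" "a \<noteq> b"
    and uv: "u \<in> S" "v \<notin> S" and S: "setdist S (- S) > 0"
  shows "\<exists>N :: (('a \<Rightarrow> 'k::real_normed_field) \<Rightarrow> 'k) set.
    nontrivial_invariant_subspace e (free_operator f e) N"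
proof -
  define K :: "('a \<Rightarrow> 'k) set"
    where "K = {\<phi> \<in> lip0 e. \<forall>x y. connected_component UNIV x y \<longrightarrow> \<phi> x = \<phi> y}"
  define T :: "(('a \<Rightarrow> 'k) \<Rightarrow> 'k) \<Rightarrow> (('a \<Rightarrow> 'k) \<Rightarrow> 'k)" where "T = free_operator f e"
  let ?N = "pre_annihilator e K"
  have K: "K \<subseteq> lip0 e" by (auto simp: K_def)
  \<comment> \<open>The definite description denotes, by existence and uniqueness for Lipschitz
    \<open>f\<close>.\<close>
  have T: "is_free_operator f e T"
    unfolding T_def free_operator_def by (rule theI'[OF ex1_free_operator[OF f]])
  have "(\<lambda>x. \<phi> (f x) - \<phi> (f e)) \<in> K" if "\<phi> \<in> K" for \<phi>
  proof -
    have "\<phi> (f x) = \<phi> (f y)" if "connected_component UNIV x y" for x y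
      using \<open>\<phi> \<in> K\<close> connected_component_image[OF lipschitz_on_continuous_on[OF f] that]
      by (simp add: K_def)
    moreover have "(\<lambda>x. \<phi> (f x) - \<phi> (f e)) \<in> lip0 e"
      using that K by (intro lip0_pullback[OF f]) auto
    ultimately show ?thesis by (auto simp: K_def)
  qed
  then have inv: "T ` ?N \<subseteq> ?N" by (intro pre_annihilator_invariant[OF f T K])
  have "(delta e a - delta e b) \<phi> = 0" if "\<phi> \<in> K" for \<phi>
    using that ab by (auto simp: K_def delta_def)
  then have "delta e a - delta e b \<in> ?N"
    unfolding pre_annihilator_def using delta_diff_in_free_space[of e a b] by blast
  then have nonzero: "{0} \<subset> ?N"
    using delta_diff_neq_0[OF ab(2)] fun_vs.subspace_0[OF subspace_pre_annihilator] by blast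
  \<comment> \<open>Subtracting the constant puts the indicator into \<open>lip0 e\<close> on
    whichever side of \<open>S\<close> the base point lies; the values at \<open>u\<close> and
    \<open>v\<close> still differ by 1.\<close>
  define \<phi> :: "'a \<Rightarrow> 'k" where "\<phi> x = indicator S x - indicator S e" for x
  have "(1 / setdist S (- S))-lipschitz_on UNIV \<phi>"
    using lipschitz_on_indicator[OF S, where 'k='k]
    by (simp add: \<phi>_def lipschitz_on_def dist_norm)
  then have \<phi>: "\<phi> \<in> lip0 e" by (auto simp: lip0_def \<phi>_def)
  then have "\<phi> \<in> K"
    unfolding K_def using indicator_eq_on_component[OF S, where 'k='k] by (auto simp: \<phi>_def)
  moreover have "(delta e u - delta e v) \<phi> \<noteq> 0" using \<phi> uv by (simp add: delta_def \<phi>_def)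
  ultimately have "delta e u - delta e v \<notin> ?N" unfolding pre_annihilator_def by blast
  moreover have "?N \<subseteq> free_space e" by (auto simp: pre_annihilator_def)
  ultimately have proper: "?N \<subset> free_space e"
    using delta_diff_in_free_space[of e u v] by blast
  show ?thesis
    using subspace_pre_annihilator closedin_pre_annihilator[OF K] nonzero proper inv
    by (auto simp: nontrivial_invariant_subspace_def T_def intro!: exI[of _ ?N])
qed

theorem proposition4p7:
  fixes e :: "'a::complete_space"
  assumes "infinite (UNIV :: 'a set)"
    and "\<exists>C\<in>components (UNIV :: 'a set). \<exists>D\<in>components (UNIV :: 'a set). C \<noteq> D"
    and "\<exists>C\<in>components (UNIV :: 'a set). \<exists>x\<in>C. \<exists>y\<in>C. x \<noteq> y"
    and "\<exists>S :: 'a set. S \<noteq> {} \<and> closed S \<and> S \<subset> UNIV \<and> setdist S (UNIV - S) > 0"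
  shows "\<forall>f :: 'a \<Rightarrow> 'a. (\<exists>L. L-lipschitz_on UNIV f) \<longrightarrow>
    (\<exists>N :: (('a \<Rightarrow> real) \<Rightarrow> real) set.
       nontrivial_invariant_subspace e (free_operator f e) N) \<and>
    (\<exists>N :: (('a \<Rightarrow> complex) \<Rightarrow> complex) set.
       nontrivial_invariant_subspace e (free_operator f e) N)"
proof -
  obtain C a b where "C \<in> components (UNIV :: 'a set)" "a \<in> C" "b \<in> C" "a \<noteq> b"
    using assms(3) by blast
  then have ab: "connected_component UNIV a b" "a \<noteq> b"
    by (auto simp: connected_component_def dest: in_components_connected)
  obtain S and u v :: 'a where S: "u \<in> S" "v \<notin> S" "setdist S (- S) > 0"
    using assms(4) by (auto simp: Compl_eq_Diff_UNIV)
  \<comment> \<open>The scalar field is a type variable in the lemma, so the real and the complex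
    case are two instances with the same points and the same \<open>S\<close>.\<close>
  show ?thesis
    by (intro allI impI conjI; elim exE; rule free_operator_invariant_subspace[OF _ ab S])
qed

end
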